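(* Let $G\in\mathbf{B}^+(\mathcal H)$ and let $$\mathbf{B}^+_G(\mathcal H)=\left\{Y\in\mathbf{B}^+(\mathcal H):\mathrm{ran}\,Y^{1/2}\cap\mathrm{ran}\,G^{1/2}=\{0\}\right\}.$$ Then $\mathbf{B}^+_G(\mathcal H)$ is the set of all fixed points of the mapping $\mu_G$, it is also the set of all fixed points of the mapping $\tau_G$, and it is the image of $\tau_G$: $\mathbf{B}^+_G(\mathcal H)=\tau_G(\mathbf{B}^+(\mathcal H))$.
   Context: $\mathcal H$ is a complex Hilbert space; $\mathbf{B}^+(\mathcal H)$ is the cone of all bounded nonnegative self-adjoint operators in $\mathcal H$. For $X,G\in\mathbf{B}^+(\mathcal H)$ the parallel sum $X:G\in\mathbf{B}^+(\mathcal H)$ is the operator with quadratic form $((X:G)h,h)=\inf\{(Xf,f)+(Gg,g): f,g\in\mathcal H,\ h=f+g\}$. The mapping $\mu_G:\mathbf{B}^+(\mathcal H)\to\mathbf{B}^+(\mathcal H)$ is $\mu_G(X)=X-X:G$; $\mu_G^{[n]}$ is its $n$-th iterate. Since $0\le\mu_G(X)\le X$, the sequence $\{\mu_G^{[n]}(X)\}$ is non-increasing, and $\tau_G:\mathbf{B}^+(\mathcal H)\to\mathbf{B}^+(\mathcal H)$ is defined by the strong limit $\tau_G(X)=\text{s-}\lim_{n\to\infty}\mu_G^{[n]}(X)$. *)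

theory Defs
  imports "HOL-Analysis.Analysis"
begin

text \<open>
  A complex Hilbert space is presented on top of its underlying real Hilbert space: the real inner
  product is the real part of the complex one, so the library's norm, metric and topology are those
  induced by \<open>cinner\<close>. The inner product is linear in its first argument. Neither separability nor
  nontriviality of the space is assumed.
\<close>

class complex_inner = real_inner +
  fixes scaleC :: "complex \<Rightarrow> 'a \<Rightarrow> 'a" (infixr "*\<^sub>C" 75)
    and cinner :: "'a \<Rightarrow> 'a \<Rightarrow> complex"
  assumes scaleC_add_right: "a *\<^sub>C (x + y) = a *\<^sub>C x + a *\<^sub>C y"
    and scaleC_add_left: "(a + b) *\<^sub>C x = a *\<^sub>C x + b *\<^sub>C x"
    and scaleC_scaleC: "a *\<^sub>C b *\<^sub>C x = (a * b) *\<^sub>C x"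
    and scaleC_of_real: "complex_of_real r *\<^sub>C x = r *\<^sub>R x"
    and cinner_commute: "cinner x y = cnj (cinner y x)"
    and cinner_add_left: "cinner (x + y) z = cinner x z + cinner y z"
    and cinner_scaleC_left: "cinner (a *\<^sub>C x) y = a * cinner x y"
    and inner_eq_Re_cinner: "inner x y = Re (cinner x y)"

class complex_hilbert_space = complex_inner + complete_space

instantiation complex :: complex_hilbert_space
begin

definition scaleC_complex :: "complex \<Rightarrow> complex \<Rightarrow> complex"
  where "scaleC_complex a x = a * x"

definition cinner_complex :: "complex \<Rightarrow> complex \<Rightarrow> complex"
  where "cinner_complex x y = x * cnj y"

instance
  by standard
    (simp_all add: scaleC_complex_def cinner_complex_def inner_complex_def scaleR_conv_of_real
      algebra_simps)

end

text \<open>The library type of bounded operators is that of bounded real-linear maps, so complex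
  linearity is required explicitly.\<close>

definition pos_ops :: "('a::complex_hilbert_space \<Rightarrow>\<^sub>L 'a) set"
  where "pos_ops = {A. (\<forall>c x. blinfun_apply A (c *\<^sub>C x) = c *\<^sub>C blinfun_apply A x)
      \<and> (\<forall>x y. cinner (blinfun_apply A x) y = cinner x (blinfun_apply A y))
      \<and> (\<forall>x. 0 \<le> Re (cinner (blinfun_apply A x) x))}"

definition op_sqrt :: "('a::complex_hilbert_space \<Rightarrow>\<^sub>L 'a) \<Rightarrow> ('a \<Rightarrow>\<^sub>L 'a)"
  where "op_sqrt A = (THE S. S \<in> pos_ops \<and> S o\<^sub>L S = A)"

text \<open>For operators in \<open>pos_ops\<close> the quadratic forms are real-valued, so taking real parts below
  loses nothing.\<close>

definition parallel_sum ::
    "('a::complex_hilbert_space \<Rightarrow>\<^sub>L 'a) \<Rightarrow> ('a \<Rightarrow>\<^sub>L 'a) \<Rightarrow> ('a \<Rightarrow>\<^sub>L 'a)"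
  where "parallel_sum X G = (THE Z. Z \<in> pos_ops \<and>
      (\<forall>h. Re (cinner (blinfun_apply Z h) h) =
        Inf {Re (cinner (blinfun_apply X f) f) + Re (cinner (blinfun_apply G g) g) |f g. h = f + g}))"

definition mu :: "('a::complex_hilbert_space \<Rightarrow>\<^sub>L 'a) \<Rightarrow> ('a \<Rightarrow>\<^sub>L 'a) \<Rightarrow> ('a \<Rightarrow>\<^sub>L 'a)"
  where "mu G X = X - parallel_sum X G"

definition tau :: "('a::complex_hilbert_space \<Rightarrow>\<^sub>L 'a) \<Rightarrow> ('a \<Rightarrow>\<^sub>L 'a) \<Rightarrow> ('a \<Rightarrow>\<^sub>L 'a)"
  where "tau G X = (THE T. T \<in> pos_ops \<and>
      (\<forall>h. (\<lambda>n. blinfun_apply ((mu G ^^ n) X) h) \<longlonglongrightarrow> blinfun_apply T h))"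

definition pos_ops_disj :: "('a::complex_hilbert_space \<Rightarrow>\<^sub>L 'a) \<Rightarrow> ('a \<Rightarrow>\<^sub>L 'a) set"
  where "pos_ops_disj G = {Y \<in> pos_ops.
      range (blinfun_apply (op_sqrt Y)) \<inter> range (blinfun_apply (op_sqrt G)) = {0}}"

end

(*
Write X_0 = X and X_(n+1) = mu_G(X_n) = X_n - X_n:G. The iterates decrease strongly to tau_G(X), and
by monotonicity of the parallel sum 0 <= tau_G(X):G <= X_n:G = X_n - X_(n+1), which tends to 0; so
tau_G(X):G = 0. Hence everything reduces to: X:G = 0 iff the ranges of A = X^(1/2) and B = G^(1/2)
meet only in 0. The form of X:G at h is the squared distance from (0, B h) to the subspace
{(A f, - B f)} of H x H, whose orthogonal complement is {(u, v). A u = B v}; this distance vanishes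
for all h iff B v = 0 whenever A u = B v.
*)
theory Submission
  imports Defs
begin

text \<open>\<open>op_sqrt\<close>, \<open>parallel_sum\<close> and \<open>tau\<close> are definite
  descriptions, so each of them says something only once existence and uniqueness are proved; hence
  the square roots, projections and monotone limits below. They are built from the real inner
  product alone, since bounded operators are here only real-linear and the product space H x H
  carries only a real inner product. Complex linearity is recovered each time from something
  canonical: the square root commutes with everything that commutes with the operator, the
  projection is determined by its orthogonality properties, and a strong limit is unique. The
  subspace {(A f, - B f)} need not be closed, so the infimum over the splittings of h need not be
  attained. The projection is therefore taken relative to the closure, and approximating sequences
  lead back to actual splittings.\<close>

definition sym_pos :: "('a::real_inner \<Rightarrow>\<^sub>L 'a) \<Rightarrow> bool"
  where "sym_pos A \<longleftrightarrow> (\<forall>x y. inner (A x) y = inner x (A y)) \<and> (\<forall>x. 0 \<le> inner (A x) x)"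

lemma sym_posD:
  assumes "sym_pos A"
  shows "inner (A x) y = inner x (A y)" "0 \<le> inner (A x) x"
  using assms by (auto simp: sym_pos_def)

lemma inner_blinfun_le: "inner (blinfun_apply A x) x \<le> norm A * (norm x)\<^sup>2"
proof -
  have "inner (A x) x \<le> norm (A x) * norm x"
    by (rule norm_cauchy_schwarz)
  also have "\<dots> \<le> (norm A * norm x) * norm x"
    by (intro mult_right_mono norm_blinfun) auto
  finally show ?thesis by (simp add: power2_eq_square mult.assoc)
qed

text \<open>The added 1 keeps the constant strictly positive even for \<open>A = 0\<close>, as
  \<open>sym_pos_norm_sq_le\<close> demands.\<close>

lemma inner_blinfun_le_Suc: "inner (blinfun_apply A x) x \<le> (norm A + 1) * (norm x)\<^sup>2"
  using inner_blinfun_le[of A x] zero_le_power2[of "norm x"] unfolding distrib_right by linarith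

text \<open>The form at x - t A x is nonnegative and at most (A x, x) - 2 t |A x|^2 + t^2 k |A x|^2;
  \<open>t = 1/k\<close> minimises this bound. The estimate turns control of forms into control of
  vectors, for the kernel, for norm bounds and for strong convergence.\<close>

lemma sym_pos_norm_sq_le:
  assumes A: "sym_pos A" and k: "k > 0" "\<And>y. inner (A y) y \<le> k * (norm y)\<^sup>2"
  shows "(norm (A x))\<^sup>2 \<le> k * inner (A x) x"
proof -
  let ?y = "x - (1/k) *\<^sub>R A x"
  have "inner (A (x - t *\<^sub>R A x)) (x - t *\<^sub>R A x)
      = inner (A x) x - 2 * t * inner (A x) (A x) + t * t * inner (A (A x)) (A x)" for t
    using sym_posD(1)[OF A, of "A x" x]
    by (simp add: blinfun.bilinear_simps inner_diff_left inner_diff_right algebra_simps)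
  from this[of "1/k"] have "inner (A ?y) ?y
      = inner (A x) x - (2/k) * (norm (A x))\<^sup>2 + (1/k)\<^sup>2 * inner (A (A x)) (A x)"
    unfolding power2_norm_eq_inner power2_eq_square[of "1/k"] by simp
  with sym_posD(2)[OF A, of ?y]
  have "0 \<le> inner (A x) x - (2/k) * (norm (A x))\<^sup>2 + (1/k)\<^sup>2 * inner (A (A x)) (A x)"
    by simp
  also have "\<dots> \<le> inner (A x) x - (2/k) * (norm (A x))\<^sup>2 + (1/k)\<^sup>2 * (k * (norm (A x))\<^sup>2)"
    by (intro add_left_mono mult_left_mono k) auto
  also have "\<dots> = inner (A x) x - (norm (A x))\<^sup>2 / k"
    using k by (simp add: power2_eq_square field_simps)
  finally show ?thesis using k by (simp add: field_simps)
qed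

lemma sym_pos_apply_eq_0:
  assumes "sym_pos A" "inner (A x) x = 0"
  shows "A x = 0"
proof -
  have "(norm (A x))\<^sup>2 \<le> (norm A + 1) * inner (A x) x"
    by (intro sym_pos_norm_sq_le assms inner_blinfun_le_Suc) (simp add: add_nonneg_pos)
  then show ?thesis using assms by simp
qed

text \<open>Polarization: by symmetry the two cross terms of the form at \<open>x + y\<close>
  coincide, so the form determines them.\<close>

lemma symmetric_form_eqI:
  fixes A B :: "'a::real_inner \<Rightarrow>\<^sub>L 'a"
  assumes A: "\<And>x y. inner (A x) y = inner x (A y)" and B: "\<And>x y. inner (B x) y = inner x (B y)"
    and eq: "\<And>x. inner (A x) x = inner (B x) x"
  shows "A = B"
proof (rule blinfun_eqI)
  fix x
  have "inner (A x) y = inner (B x) y" for y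
    using eq[of "x + y"] eq[of x] eq[of y] A[of y x] B[of y x]
    by (simp add: blinfun.bilinear_simps inner_add_left inner_add_right inner_commute)
  then show "A x = B x"
    by (metis inner_diff_left inner_eq_zero_iff right_minus_eq)
qed

section \<open>Existence and uniqueness of positive square roots\<close>

text \<open>The iteration for \<open>1 - sqrt (1 - B)\<close>, together with its scalar instance \<open>B = 1\<close>, whose
  increments dominate the operator increments in norm.\<close>

primrec sqrt_iter :: "('a::real_normed_vector \<Rightarrow>\<^sub>L 'a) \<Rightarrow> nat \<Rightarrow> ('a \<Rightarrow>\<^sub>L 'a)" where
  "sqrt_iter B 0 = 0"
| "sqrt_iter B (Suc n) = (1/2) *\<^sub>R (B + (sqrt_iter B n o\<^sub>L sqrt_iter B n))"

primrec sqrt_majorant :: "nat \<Rightarrow> real" where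
  "sqrt_majorant 0 = 0"
| "sqrt_majorant (Suc n) = (1 + (sqrt_majorant n)\<^sup>2) / 2"

lemma sqrt_majorant_bounds: "0 \<le> sqrt_majorant n \<and> sqrt_majorant n \<le> 1"
  by (induction n) (auto simp: power_le_one)

lemma incseq_sqrt_majorant: "incseq sqrt_majorant"
proof (rule incseq_SucI)
  fix n
  have "0 \<le> (1 - sqrt_majorant n)\<^sup>2" by simp
  then show "sqrt_majorant n \<le> sqrt_majorant (Suc n)"
    by (simp add: power2_eq_square algebra_simps)
qed

lemma norm_sqrt_iter_le:
  assumes "norm B \<le> 1"
  shows "norm (sqrt_iter B n) \<le> sqrt_majorant n"
proof (induction n)
  case (Suc n)
  have "norm (sqrt_iter B n o\<^sub>L sqrt_iter B n) \<le> norm (sqrt_iter B n) * norm (sqrt_iter B n)"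
    by (rule norm_blinfun_compose)
  also have "\<dots> \<le> (sqrt_majorant n)\<^sup>2"
    unfolding power2_eq_square by (intro mult_mono Suc) (use sqrt_majorant_bounds in auto)
  finally show ?case
    using norm_triangle_mono[OF assms, of "sqrt_iter B n o\<^sub>L sqrt_iter B n"] by simp
qed simp

text \<open>The splitting P^2 - Q^2 = P (P - Q) + (P - Q) Q holds without commutation and mirrors
  the scalar p^2 - q^2, while \<open>B\<close> cancels. This is the induction step for comparing
  increments.\<close>

lemma norm_half_square_diff_le:
  fixes B P Q :: "'a::real_normed_vector \<Rightarrow>\<^sub>L 'a"
  assumes "norm P \<le> p" "norm Q \<le> q" "norm (P - Q) \<le> p - q"
  shows "norm ((1/2) *\<^sub>R (B + (P o\<^sub>L P)) - (1/2) *\<^sub>R (B + (Q o\<^sub>L Q))) \<le> (1 + p\<^sup>2) / 2 - (1 + q\<^sup>2) / 2"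
proof -
  have 0: "0 \<le> p" "0 \<le> q" "0 \<le> p - q"
    using assms norm_ge_zero order_trans by blast+
  have "(P o\<^sub>L P) - (Q o\<^sub>L Q) = (P o\<^sub>L (P - Q)) + ((P - Q) o\<^sub>L Q)"
    by (rule blinfun_eqI) (simp add: blinfun.bilinear_simps)
  then have "norm ((P o\<^sub>L P) - (Q o\<^sub>L Q)) \<le> norm P * norm (P - Q) + norm (P - Q) * norm Q"
    by (metis norm_triangle_mono norm_blinfun_compose)
  also have "\<dots> \<le> p * (p - q) + (p - q) * q"
    by (intro add_mono mult_mono assms norm_ge_zero 0)
  finally have "norm ((P o\<^sub>L P) - (Q o\<^sub>L Q)) \<le> p\<^sup>2 - q\<^sup>2"
    by (simp add: power2_eq_square algebra_simps)
  moreover have "(1/2) *\<^sub>R (B + (P o\<^sub>L P)) - (1/2) *\<^sub>R (B + (Q o\<^sub>L Q))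
      = (1/2) *\<^sub>R ((P o\<^sub>L P) - (Q o\<^sub>L Q))"
    by (simp flip: scaleR_diff_right)
  ultimately show ?thesis
    by (simp only: norm_scaleR) (simp add: field_simps)
qed

lemma norm_sqrt_iter_Suc_diff_le:
  assumes "norm B \<le> 1"
  shows "norm (sqrt_iter B (Suc n) - sqrt_iter B n) \<le> sqrt_majorant (Suc n) - sqrt_majorant n"
proof (induction n)
  case 0
  then show ?case using assms by simp
next
  case (Suc n)
  show ?case
    unfolding sqrt_iter.simps(2)[of B "Suc n"] sqrt_majorant.simps(2)[of "Suc n"]
    \<comment> \<open>Only the subtracted, older iterate is to be unfolded; the earlier occurrences
      sit inside the square of the newer one and must stay as they are.\<close>
    by (subst (3) sqrt_iter.simps(2), subst (2) sqrt_majorant.simps(2))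
      (intro norm_half_square_diff_le norm_sqrt_iter_le assms Suc)
qed

lemma Cauchy_of_majorant:
  fixes Y :: "nat \<Rightarrow> 'b::real_normed_vector"
  assumes Y: "\<And>n. norm (Y (Suc n) - Y n) \<le> y (Suc n) - y n" and y: "Cauchy y"
  shows "Cauchy Y"
proof (rule metric_CauchyI)
  have le: "norm (Y (n + k) - Y n) \<le> y (n + k) - y n" for n k
  proof (induction k)
    case (Suc k)
    show ?case
      using Suc Y[of "n + k"] norm_triangle_ineq[of "Y (Suc (n + k)) - Y (n + k)" "Y (n + k) - Y n"]
      by simp
  qed simp
  have le': "dist (Y m) (Y n) \<le> dist (y m) (y n)" for m n
  proof (cases "m \<le> n")
    case True
    then show ?thesis using le[of m "n - m"] by (simp add: dist_norm norm_minus_commute)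
  next
    case False
    then show ?thesis using le[of n "m - n"] by (simp add: dist_norm)
  qed
  fix e :: real assume "e > 0"
  then obtain M where "\<And>m n. m \<ge> M \<Longrightarrow> n \<ge> M \<Longrightarrow> dist (y m) (y n) < e"
    using y by (meson metric_CauchyD)
  then show "\<exists>M. \<forall>m\<ge>M. \<forall>n\<ge>M. dist (Y m) (Y n) < e"
    using le' le_less_trans by blast
qed

text \<open>Every iterate is a polynomial in \<open>B\<close>. In the limit this gives the
  commutation property on which both uniqueness and complex linearity of the square root
  rest.\<close>

lemma sqrt_iter_commute:
  assumes "R o\<^sub>L B = B o\<^sub>L R"
  shows "R o\<^sub>L sqrt_iter B n = sqrt_iter B n o\<^sub>L R"
proof (induction n)
  case (Suc n)
  have B: "R (B x) = B (R x)" for x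
    by (metis assms blinfun_apply_blinfun_compose)
  have "R (sqrt_iter B n x) = sqrt_iter B n (R x)" for x
    by (metis Suc blinfun_apply_blinfun_compose)
  then show ?case
    by (intro blinfun_eqI) (simp add: blinfun.bilinear_simps B)
qed simp

lemma sqrt_iter_symmetric:
  fixes B :: "'a::real_inner \<Rightarrow>\<^sub>L 'a"
  assumes "\<And>x y. inner (B x) y = inner x (B y)"
  shows "inner (sqrt_iter B n x) y = inner x (sqrt_iter B n y)"
  by (induction n arbitrary: x y)
    (simp_all add: assms blinfun.bilinear_simps inner_add_left inner_add_right)

text \<open>For B = 1 - A the limit Y of the iteration satisfies 2 Y = B + Y^2, that is (1 - Y)^2 =
  1 - B = A. The assumption on the form of \<open>A\<close> serves to give |B| \<le> 1, so that the
  scalar majorant applies.\<close>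

lemma sym_pos_contraction_sqrt:
  fixes A :: "'a::{real_inner, banach} \<Rightarrow>\<^sub>L 'a"
  assumes A: "sym_pos A" and A1: "\<And>x. inner (A x) x \<le> (norm x)\<^sup>2"
  obtains S where "sym_pos S" "S o\<^sub>L S = A" "\<And>R. R o\<^sub>L A = A o\<^sub>L R \<Longrightarrow> R o\<^sub>L S = S o\<^sub>L R"
proof -
  define B where "B = id_blinfun - A"
  have Bsym: "inner (B x) y = inner x (B y)" for x y
    using sym_posD[OF A] by (simp add: B_def blinfun.bilinear_simps inner_diff_left inner_diff_right)
  have Bform: "inner (B x) x = (norm x)\<^sup>2 - inner (A x) x" for x
    by (simp add: B_def blinfun.diff_left inner_diff_left power2_norm_eq_inner)
  have B0: "sym_pos B"
    unfolding sym_pos_def using Bsym Bform A1 by auto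
  have B1: "inner (B x) x \<le> 1 * (norm x)\<^sup>2" for x
    using sym_posD(2)[OF A, of x] Bform[of x] by simp
  have "norm (B x) \<le> 1 * norm x" for x
  proof -
    have "(norm (B x))\<^sup>2 \<le> 1 * inner (B x) x"
      by (rule sym_pos_norm_sq_le[OF B0 _ B1]) simp
    also have "\<dots> \<le> (norm x)\<^sup>2" using B1[of x] by simp
    finally show ?thesis by simp
  qed
  then have nB: "norm B \<le> 1"
    by (intro norm_blinfun_bound) auto
  let ?Y = "sqrt_iter B"
  obtain l where "sqrt_majorant \<longlonglongrightarrow> l"
    using incseq_convergent[OF incseq_sqrt_majorant, of 1] sqrt_majorant_bounds by metis
  then have "Cauchy sqrt_majorant"
    by (rule LIMSEQ_imp_Cauchy)
  then have "Cauchy ?Y"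
    using norm_sqrt_iter_Suc_diff_le[OF nB]
    by (intro Cauchy_of_majorant[where Y = ?Y and y = sqrt_majorant])
  then have "convergent ?Y"
    by (rule Cauchy_convergent)
  then obtain Y where Y: "?Y \<longlonglongrightarrow> Y"
    by (auto simp: convergent_def)
  have Yx: "(\<lambda>n. ?Y n x) \<longlonglongrightarrow> Y x" for x
    by (intro tendsto_intros Y)
  \<comment> \<open>The bound 1 passes to the limit and makes the form of
    \<open>id_blinfun - Y\<close> nonnegative.\<close>
  have "norm (?Y n) \<le> 1" for n
    using norm_sqrt_iter_le[OF nB, of n] sqrt_majorant_bounds[of n] by linarith
  then have nY: "norm Y \<le> 1"
    by (intro LIMSEQ_le_const2[OF tendsto_norm[OF Y]]) auto
  have "(\<lambda>n. ?Y (Suc n)) \<longlonglongrightarrow> (1/2) *\<^sub>R (B + (Y o\<^sub>L Y))"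
    unfolding sqrt_iter.simps by (intro tendsto_intros Y)
  then have Yeq: "Y = (1/2) *\<^sub>R (B + (Y o\<^sub>L Y))"
    using LIMSEQ_Suc[OF Y] LIMSEQ_unique by blast
  have Ysym: "inner (Y x) y = inner x (Y y)" for x y
  proof (rule LIMSEQ_unique)
    show "(\<lambda>n. inner (?Y n x) y) \<longlonglongrightarrow> inner (Y x) y"
      by (intro tendsto_intros Yx)
    show "(\<lambda>n. inner (?Y n x) y) \<longlonglongrightarrow> inner x (Y y)"
      unfolding sqrt_iter_symmetric[OF Bsym] by (intro tendsto_intros Yx)
  qed
  have Ycomm: "R o\<^sub>L Y = Y o\<^sub>L R" if "R o\<^sub>L B = B o\<^sub>L R" for R
  proof (rule LIMSEQ_unique)
    show "(\<lambda>n. R o\<^sub>L ?Y n) \<longlonglongrightarrow> (R o\<^sub>L Y)"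
      by (intro tendsto_intros Y)
    show "(\<lambda>n. R o\<^sub>L ?Y n) \<longlonglongrightarrow> (Y o\<^sub>L R)"
      unfolding sqrt_iter_commute[OF that] by (intro tendsto_intros Y)
  qed
  define S where "S = id_blinfun - Y"
  show thesis
  proof (rule that[of S])
    have "inner (Y x) x \<le> (norm x)\<^sup>2" for x
      using inner_blinfun_le[of Y x] mult_right_mono[OF nY, of "(norm x)\<^sup>2"] by simp
    moreover have "inner (S x) x = (norm x)\<^sup>2 - inner (Y x) x" for x
      by (simp add: S_def blinfun.diff_left inner_diff_left power2_norm_eq_inner)
    moreover have "inner (S x) y = inner x (S y)" for x y
      by (simp add: S_def blinfun.diff_left inner_diff_left inner_diff_right Ysym)
    ultimately show "sym_pos S"
      unfolding sym_pos_def by simp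
    show "S o\<^sub>L S = A"
    proof (rule blinfun_eqI)
      fix x
      have "2 *\<^sub>R Y x = B x + Y (Y x)"
        using arg_cong[OF Yeq, of "\<lambda>Z. 2 *\<^sub>R blinfun_apply Z x"]
        by (simp add: blinfun.bilinear_simps)
      then show "(S o\<^sub>L S) x = A x"
        by (simp add: S_def B_def blinfun.bilinear_simps scaleR_2 algebra_simps)
    qed
    show "R o\<^sub>L S = S o\<^sub>L R" if comm: "R o\<^sub>L A = A o\<^sub>L R" for R
    proof -
      have "R (A x) = A (R x)" for x
        by (metis comm blinfun_apply_blinfun_compose)
      then have "R o\<^sub>L B = B o\<^sub>L R"
        by (intro blinfun_eqI) (simp add: B_def blinfun.bilinear_simps)
      then have "R (Y x) = Y (R x)" for x
        by (metis Ycomm blinfun_apply_blinfun_compose)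
      then show ?thesis
        by (intro blinfun_eqI) (simp add: S_def blinfun.bilinear_simps)
    qed
  qed
qed

lemma sym_pos_scaleR:
  assumes "sym_pos A" "0 \<le> c"
  shows "sym_pos (c *\<^sub>R A)"
  using assms sym_posD[OF assms(1)] unfolding sym_pos_def by (auto simp: blinfun.bilinear_simps)

lemma blinfun_compose_scaleR:
  "(c *\<^sub>R A) o\<^sub>L B = c *\<^sub>R (A o\<^sub>L B)" "A o\<^sub>L (c *\<^sub>R B) = c *\<^sub>R (A o\<^sub>L B)"
  by (auto intro!: blinfun_eqI simp: blinfun.bilinear_simps)

text \<open>Dividing by \<open>c\<close> brings the form below |x|^2; the root of the rescaled
  operator is multiplied by \<open>sqrt c\<close> to compensate.\<close>

lemma sym_pos_sqrt:
  fixes A :: "'a::{real_inner, banach} \<Rightarrow>\<^sub>L 'a"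
  assumes A: "sym_pos A"
  obtains S where "sym_pos S" "S o\<^sub>L S = A" "\<And>R. R o\<^sub>L A = A o\<^sub>L R \<Longrightarrow> R o\<^sub>L S = S o\<^sub>L R"
proof -
  define c where "c = norm A + 1"
  have c: "c > 0" by (simp add: c_def add_nonneg_pos)
  have "inner (((1/c) *\<^sub>R A) x) x \<le> (norm x)\<^sup>2" for x
  proof -
    have "inner (A x) x \<le> c * (norm x)\<^sup>2"
      unfolding c_def by (rule inner_blinfun_le_Suc)
    then show ?thesis using c by (simp add: blinfun.scaleR_left pos_divide_le_eq mult.commute)
  qed
  moreover have "sym_pos ((1/c) *\<^sub>R A)"
    using sym_pos_scaleR[OF A, of "1/c"] c by simp
  ultimately obtain S where S: "sym_pos S" "S o\<^sub>L S = (1/c) *\<^sub>R A"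
    "\<And>R. R o\<^sub>L ((1/c) *\<^sub>R A) = ((1/c) *\<^sub>R A) o\<^sub>L R \<Longrightarrow> R o\<^sub>L S = S o\<^sub>L R"
    using sym_pos_contraction_sqrt by blast
  show thesis
  proof (rule that[of "sqrt c *\<^sub>R S"])
    show "sym_pos (sqrt c *\<^sub>R S)" using S(1) c by (simp add: sym_pos_scaleR)
    show "(sqrt c *\<^sub>R S) o\<^sub>L (sqrt c *\<^sub>R S) = A" using S(2) c by (simp add: blinfun_compose_scaleR)
    show "R o\<^sub>L (sqrt c *\<^sub>R S) = (sqrt c *\<^sub>R S) o\<^sub>L R" if comm: "R o\<^sub>L A = A o\<^sub>L R" for R
    proof -
      have "R o\<^sub>L S = S o\<^sub>L R"
        by (rule S(3)) (simp only: blinfun_compose_scaleR comm)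
      then show ?thesis by (simp only: blinfun_compose_scaleR)
    qed
  qed
qed

text \<open>Commutation gives (S + R)(S - R) = 0. At y = S x - R x two nonnegative forms thus add up
  to 0, so S y = R y = 0, and then |y|^2 = (x, S y - R y) = 0.\<close>

lemma sym_pos_sqrt_unique:
  fixes S R :: "'a::{real_inner, banach} \<Rightarrow>\<^sub>L 'a"
  assumes S: "sym_pos S" and R: "sym_pos R" and eq: "S o\<^sub>L S = R o\<^sub>L R"
    and comm: "R o\<^sub>L S = S o\<^sub>L R"
  shows "S = R"
proof (rule blinfun_eqI)
  fix x
  have eq': "S (S z) = R (R z)" and comm': "R (S z) = S (R z)" for z
    by (metis eq comm blinfun_apply_blinfun_compose)+
  let ?y = "S x - R x"
  have "S ?y + R ?y = 0" by (simp add: blinfun.bilinear_simps eq' comm')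
  then have "inner (S ?y) ?y + inner (R ?y) ?y = 0"
    by (simp flip: inner_add_left)
  then have "inner (S ?y) ?y = 0" "inner (R ?y) ?y = 0"
    using sym_posD(2)[OF S, of ?y] sym_posD(2)[OF R, of ?y] by linarith+
  then have "S ?y = 0" "R ?y = 0"
    using sym_pos_apply_eq_0 S R by blast+
  moreover have "inner ?y ?y = inner x (S ?y) - inner x (R ?y)"
    by (simp add: inner_diff_left sym_posD(1)[OF S] sym_posD(1)[OF R])
  ultimately show "S x = R x" by simp
qed

section \<open>Orthogonal projections for closed real subspaces\<close>

lemma subspace_closure:
  fixes M :: "'b::real_normed_vector set"
  assumes M: "subspace M"
  shows "subspace (closure M)"
proof (rule subspaceI)
  show "0 \<in> closure M"
    using subspace_0[OF M] closure_subset by blast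
next
  fix x y assume "x \<in> closure M" "y \<in> closure M"
  then obtain f g where fg: "\<And>n. f n \<in> M" "f \<longlonglongrightarrow> x" "\<And>n. g n \<in> M" "g \<longlonglongrightarrow> y"
    by (auto simp: closure_sequential)
  then have "(\<lambda>n. f n + g n) \<longlonglongrightarrow> x + y" "\<And>n. f n + g n \<in> M"
    using subspace_add[OF M] by (auto intro: tendsto_add)
  then show "x + y \<in> closure M"
    unfolding closure_sequential by (intro exI[of _ "\<lambda>n. f n + g n"]) auto
next
  fix c :: real and x assume "x \<in> closure M"
  then obtain f where f: "\<And>n. f n \<in> M" "f \<longlonglongrightarrow> x"
    by (auto simp: closure_sequential)
  then have "(\<lambda>n. c *\<^sub>R f n) \<longlonglongrightarrow> c *\<^sub>R x" "\<And>n. c *\<^sub>R f n \<in> M"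
    using subspace_scale[OF M] by (auto intro: tendsto_scaleR)
  then show "c *\<^sub>R x \<in> closure M"
    unfolding closure_sequential by (intro exI[of _ "\<lambda>n. c *\<^sub>R f n"]) auto
qed

lemma nearest_point_orthogonal:
  fixes N :: "'b::real_inner set"
  assumes N: "subspace N" and q: "q \<in> N" and min: "\<And>s. s \<in> N \<Longrightarrow> (norm (w - q))\<^sup>2 \<le> (norm (w - s))\<^sup>2"
    and n: "n \<in> N"
  shows "inner (w - q) n = 0"
proof (cases "n = 0")
  case False
  define r where "r = inner (w - q) n"
  define k where "k = inner n n"
  have k: "k > 0" using False by (simp add: k_def)
  have expand: "(norm (w - (q + t *\<^sub>R n)))\<^sup>2 = (norm (w - q))\<^sup>2 - 2 * t * r + t * t * k" for t
    unfolding power2_norm_eq_inner r_def k_def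
    by (simp add: inner_diff_left inner_diff_right inner_add_left inner_add_right inner_commute
        algebra_simps)
  \<comment> \<open>The coefficient \<open>r / k\<close> minimises the quadratic polynomial in
    \<open>t\<close> just expanded.\<close>
  have "q + (r / k) *\<^sub>R n \<in> N"
    using N q n by (simp add: subspace_add subspace_scale)
  from min[OF this] have "2 * (r / k) * r \<le> (r / k) * (r / k) * k"
    unfolding expand by simp
  then have "r * r \<le> 0"
    using k by (simp add: field_simps)
  then show ?thesis
    unfolding r_def[symmetric] by (auto simp: mult_le_0_iff)
qed simp

lemma orthogonal_decomposition:
  fixes N :: "'b::{real_inner, complete_space} set"
  assumes N: "subspace N" and cl: "closed N"
  obtains q where "q \<in> N" "\<And>n. n \<in> N \<Longrightarrow> inner (w - q) n = 0"
proof -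
  define D where "D = (\<lambda>s. (norm (w - s))\<^sup>2) ` N"
  define d where "d = Inf D"
  have "D \<noteq> {}" using subspace_0[OF N] by (auto simp: D_def)
  have "bdd_below D" by (rule bdd_belowI[of _ 0]) (auto simp: D_def)
  have d_le: "d \<le> (norm (w - s))\<^sup>2" if "s \<in> N" for s
    unfolding d_def using \<open>bdd_below D\<close> that by (intro cInf_lower) (auto simp: D_def)
  have "\<exists>s\<in>N. (norm (w - s))\<^sup>2 < d + inverse (real (Suc n))" for n
    using cInf_lessD[OF \<open>D \<noteq> {}\<close>, of "d + inverse (real (Suc n))"] by (auto simp: D_def d_def)
  then obtain s where sN: "\<And>n. s n \<in> N"
    and s: "\<And>n. (norm (w - s n))\<^sup>2 < d + inverse (real (Suc n))"
    by metis
  have close: "(norm (s m - s n))\<^sup>2 \<le> 2 * inverse (real (Suc m)) + 2 * inverse (real (Suc n))" for m n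
  proof -
    have "(1/2) *\<^sub>R (s m + s n) \<in> N"
      using N sN by (simp add: subspace_add subspace_scale)
    note mid = d_le[OF this]
    \<comment> \<open>Parallelogram law for \<open>w - s m\<close> and \<open>w - s n\<close>. The
      midpoint lies in \<open>N\<close>, so the last term is at most -4 d and cancels the d in the
      two others.\<close>
    have "(norm (s m - s n))\<^sup>2 = 2 * (norm (w - s m))\<^sup>2 + 2 * (norm (w - s n))\<^sup>2
        - 4 * (norm (w - (1/2) *\<^sub>R (s m + s n)))\<^sup>2"
      unfolding power2_norm_eq_inner
      by (simp add: inner_diff_left inner_diff_right inner_add_left inner_add_right inner_commute
          algebra_simps)
    then show ?thesis using mid s[of m] s[of n] by linarith
  qed
  have "Cauchy s"
  proof (rule CauchyI)
    fix e :: real assume e: "e > 0"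
    then obtain M where M: "inverse (real (Suc M)) < e\<^sup>2 / 4"
      using reals_Archimedean[of "e\<^sup>2 / 4"] by auto
    show "\<exists>M. \<forall>m\<ge>M. \<forall>n\<ge>M. norm (s m - s n) < e"
    proof (intro exI[of _ M] allI impI)
      fix m n assume "M \<le> m" "M \<le> n"
      then have "inverse (real (Suc m)) \<le> inverse (real (Suc M))"
        "inverse (real (Suc n)) \<le> inverse (real (Suc M))"
        by (auto intro!: le_imp_inverse_le)
      then have "(norm (s m - s n))\<^sup>2 < e\<^sup>2"
        using close[of m n] M by linarith
      then show "norm (s m - s n) < e"
        using e by (simp add: power2_less_imp_less)
    qed
  qed
  then obtain q where q: "s \<longlonglongrightarrow> q"
    using Cauchy_convergent by (auto simp: convergent_def)
  have qN: "q \<in> N"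
    using closed_sequentially[OF cl] sN q by blast
  have "(norm (w - q))\<^sup>2 \<le> d + 0"
  proof (rule LIMSEQ_le)
    show "(\<lambda>n. (norm (w - s n))\<^sup>2) \<longlonglongrightarrow> (norm (w - q))\<^sup>2"
      by (intro tendsto_intros q)
    show "(\<lambda>n. d + inverse (real (Suc n))) \<longlonglongrightarrow> d + 0"
      by (intro tendsto_add tendsto_const LIMSEQ_inverse_real_of_nat)
    show "\<exists>N. \<forall>n\<ge>N. (norm (w - s n))\<^sup>2 \<le> d + inverse (real (Suc n))"
      using s less_imp_le by blast
  qed
  then have "(norm (w - q))\<^sup>2 \<le> (norm (w - s))\<^sup>2" if "s \<in> N" for s
    using d_le[OF that] by linarith
  from nearest_point_orthogonal[OF N qN this] qN show thesis
    using that by blast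
qed

text \<open>The last conclusion, that the decomposition determines \<open>P w\<close>, gives
  linearity here, and later invariance under shifts by \<open>N\<close> and compatibility with
  complex scalars.\<close>

lemma orthogonal_complement_projection:
  fixes N :: "'b::{real_inner, complete_space} set"
  assumes N: "subspace N" and cl: "closed N"
  obtains P where "bounded_linear P" "\<And>w. w - P w \<in> N" "\<And>w n. n \<in> N \<Longrightarrow> inner (P w) n = 0"
    "\<And>w p. w - p \<in> N \<Longrightarrow> (\<And>n. n \<in> N \<Longrightarrow> inner p n = 0) \<Longrightarrow> P w = p"
proof -
  have "\<exists>p. w - p \<in> N \<and> (\<forall>n\<in>N. inner p n = 0)" for w
  proof -
    obtain q where "q \<in> N" "\<And>n. n \<in> N \<Longrightarrow> inner (w - q) n = 0"
      using orthogonal_decomposition[OF assms] by blast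
    then show ?thesis by (intro exI[of _ "w - q"]) auto
  qed
  then obtain P where P: "\<And>w. w - P w \<in> N" "\<And>w n. n \<in> N \<Longrightarrow> inner (P w) n = 0"
    by metis
  have uniq: "P w = p" if p: "w - p \<in> N" "\<And>n. n \<in> N \<Longrightarrow> inner p n = 0" for w p
  proof -
    have "(w - p) - (w - P w) \<in> N"
      using subspace_diff[OF N p(1) P(1)] .
    then have "P w - p \<in> N" by simp
    from P(2)[OF this, of w] p(2)[OF this] have "inner (P w - p) (P w - p) = 0"
      by (simp add: inner_diff_left)
    then show ?thesis by simp
  qed
  have "bounded_linear P"
  proof (rule bounded_linear_intro[where K = 1])
    show "P (x + y) = P x + P y" for x y
    proof (rule uniq)
      show "x + y - (P x + P y) \<in> N"
        using subspace_add[OF N P(1)[of x] P(1)[of y]] by (simp add: algebra_simps)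
    qed (simp add: inner_add_left P(2))
    show "P (r *\<^sub>R x) = r *\<^sub>R P x" for r x
    proof (rule uniq)
      show "r *\<^sub>R x - r *\<^sub>R P x \<in> N"
        using subspace_scale[OF N P(1)[of x], of r] by (simp add: scaleR_diff_right)
    qed (simp add: P(2))
    show "norm (P x) \<le> norm x * 1" for x
    proof -
      have "inner (P x) (x - P x) = 0" by (rule P(2)[OF P(1)])
      then have "norm (P x) * norm (P x) \<le> norm (P x) * norm x"
        using norm_cauchy_schwarz[of "P x" x]
        by (simp add: inner_diff_right power2_norm_eq_inner flip: power2_eq_square)
      then show ?thesis
        by (cases "norm (P x) = 0") (auto simp: mult_le_cancel_left)
    qed
  qed
  then show thesis using that P uniq by blast
qed

section \<open>From the real to the complex structure\<close>

instance complex_hilbert_space \<subseteq> banach ..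

lemma cinner_scaleC_right: "cinner x (a *\<^sub>C y) = cnj a * cinner x (y::'a::complex_inner)"
  by (metis cinner_commute cinner_scaleC_left complex_cnj_mult)

lemma inner_scaleC_left: "inner (a *\<^sub>C x) y = inner x (cnj a *\<^sub>C (y::'a::complex_inner))"
  by (simp add: inner_eq_Re_cinner cinner_scaleC_left cinner_scaleC_right)

text \<open>Multiplication by a scalar becomes a bounded operator itself, so complex linearity can
  be expressed as commutation with it. The norm bound comes from its adjoint, multiplication by
  \<open>cnj c\<close>.\<close>

lemma bounded_linear_scaleC: "bounded_linear (\<lambda>x::'a::complex_inner. c *\<^sub>C x)"
proof (rule bounded_linear_intro[where K = "cmod c"])
  show "c *\<^sub>C (x + y) = c *\<^sub>C x + c *\<^sub>C y" for x y :: 'a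
    by (rule scaleC_add_right)
  show "c *\<^sub>C r *\<^sub>R x = r *\<^sub>R c *\<^sub>C x" for r and x :: 'a
    by (metis mult.commute scaleC_of_real scaleC_scaleC)
  show "norm (c *\<^sub>C x) \<le> norm x * cmod c" for x :: 'a
  proof -
    have "inner (c *\<^sub>C x) (c *\<^sub>C x) = inner x (((cmod c)\<^sup>2) *\<^sub>R x)"
      by (metis inner_scaleC_left scaleC_scaleC scaleC_of_real complex_norm_square mult.commute
          of_real_power)
    then have "(norm (c *\<^sub>C x))\<^sup>2 = (norm x * cmod c)\<^sup>2"
      by (simp add: power2_norm_eq_inner power_mult_distrib mult.commute)
    then show ?thesis
      by (simp add: power2_eq_imp_eq)
  qed
qed

lemma pos_ops_iff:
  "A \<in> pos_ops \<longleftrightarrow> (\<forall>c x. A (c *\<^sub>C x) = c *\<^sub>C A x) \<and> sym_pos A"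
proof
  assume "A \<in> pos_ops"
  then show "(\<forall>c x. A (c *\<^sub>C x) = c *\<^sub>C A x) \<and> sym_pos A"
    unfolding pos_ops_def sym_pos_def inner_eq_Re_cinner by auto
next
  assume A: "(\<forall>c x. A (c *\<^sub>C x) = c *\<^sub>C A x) \<and> sym_pos A"
  then have sym: "inner (A x) y = inner x (A y)" for x y
    by (simp add: sym_posD)
  have "cinner (A x) y = cinner x (A y)" for x y
  proof (rule complex_eqI)
    show "Re (cinner (A x) y) = Re (cinner x (A y))"
      using sym[of x y] by (simp add: inner_eq_Re_cinner)
    show "Im (cinner (A x) y) = Im (cinner x (A y))"
      \<comment> \<open>For complex z, Im z = Re (- i z), and complex linearity of \<open>A\<close>
        moves the factor - i outside.\<close>
      using sym[of "(- \<i>) *\<^sub>C x" y] A by (simp add: inner_eq_Re_cinner cinner_scaleC_left)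
  qed
  then show "A \<in> pos_ops"
    using A unfolding pos_ops_def sym_pos_def inner_eq_Re_cinner by auto
qed

lemma pos_opsD:
  assumes "A \<in> pos_ops"
  shows "A (c *\<^sub>C x) = c *\<^sub>C A x" "sym_pos A" "inner (A x) y = inner x (A y)" "0 \<le> inner (A x) x"
  using assms unfolding pos_ops_iff sym_pos_def by auto

lemma pos_ops_form_eqI:
  assumes "A \<in> pos_ops" "B \<in> pos_ops" "\<And>x. inner (A x) x = inner (B x) x"
  shows "A = B"
  using assms by (intro symmetric_form_eqI) (auto simp: pos_opsD)

lemma scaleC_zero_right: "c *\<^sub>C (0::'a::complex_inner) = 0"
  using linear_0[OF bounded_linear.linear[OF bounded_linear_scaleC]] .

lemma scaleC_diff_right: "c *\<^sub>C (x - y::'a::complex_inner) = c *\<^sub>C x - c *\<^sub>C y"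
  using linear_diff[OF bounded_linear.linear[OF bounded_linear_scaleC]] .

lemma zero_in_pos_ops: "0 \<in> pos_ops"
  by (simp add: pos_ops_iff sym_pos_def scaleC_zero_right)

lemma pos_ops_add:
  assumes "A \<in> pos_ops" "B \<in> pos_ops"
  shows "A + B \<in> pos_ops"
  unfolding pos_ops_iff sym_pos_def blinfun.add_left inner_add_left inner_add_right
    pos_opsD(1)[OF assms(1)] pos_opsD(1)[OF assms(2)] scaleC_add_right
  using pos_opsD(3,4)[OF assms(1)] pos_opsD(3,4)[OF assms(2)] by auto

lemma pos_ops_diff:
  assumes "A \<in> pos_ops" "B \<in> pos_ops" "\<And>x. inner (B x) x \<le> inner (A x) x"
  shows "A - B \<in> pos_ops"
  unfolding pos_ops_iff sym_pos_def blinfun.diff_left inner_diff_left inner_diff_right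
    pos_opsD(1)[OF assms(1)] pos_opsD(1)[OF assms(2)] scaleC_diff_right
  using pos_opsD(3)[OF assms(1)] pos_opsD(3)[OF assms(2)] assms(3) by auto

text \<open>The root \<open>S\<close> commutes with multiplication by any scalar because
  \<open>A\<close> does. Any other positive root \<open>R\<close> commutes with R^2 = A, hence with
  \<open>S\<close>, so uniqueness among commuting roots suffices.\<close>

lemma op_sqrt:
  assumes "A \<in> pos_ops"
  shows "op_sqrt A \<in> pos_ops" "op_sqrt A o\<^sub>L op_sqrt A = A"
proof -
  obtain S where S: "sym_pos S" "S o\<^sub>L S = A" "\<And>R. R o\<^sub>L A = A o\<^sub>L R \<Longrightarrow> R o\<^sub>L S = S o\<^sub>L R"
    using sym_pos_sqrt[OF pos_opsD(2)[OF assms]] by blast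
  have "S (c *\<^sub>C x) = c *\<^sub>C S x" for c x
  proof -
    let ?C = "Blinfun (\<lambda>x::'a. c *\<^sub>C x)"
    have C: "?C y = c *\<^sub>C y" for y
      by (simp add: bounded_linear_Blinfun_apply bounded_linear_scaleC)
    have "?C o\<^sub>L A = A o\<^sub>L ?C"
      by (rule blinfun_eqI) (simp add: C pos_opsD(1)[OF assms])
    from S(3)[OF this] show ?thesis
      by (metis C blinfun_apply_blinfun_compose)
  qed
  then have "S \<in> pos_ops" using S(1) by (simp add: pos_ops_iff)
  have "\<exists>!S. S \<in> pos_ops \<and> S o\<^sub>L S = A"
  proof (rule ex1I[of _ S])
    show "S \<in> pos_ops \<and> S o\<^sub>L S = A" using \<open>S \<in> pos_ops\<close> S(2) by simp
    fix R assume R: "R \<in> pos_ops \<and> R o\<^sub>L R = A"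
    have "R o\<^sub>L (R o\<^sub>L R) = (R o\<^sub>L R) o\<^sub>L R"
      by (rule blinfun_eqI) simp
    then have comm: "R o\<^sub>L S = S o\<^sub>L R"
      using R by (intro S(3)) simp
    have "S = R"
      by (rule sym_pos_sqrt_unique[OF S(1) _ _ comm]) (use R S(2) pos_opsD(2) in auto)
    then show "R = S" by simp
  qed
  from theI'[OF this] show "op_sqrt A \<in> pos_ops" "op_sqrt A o\<^sub>L op_sqrt A = A"
    by (auto simp: op_sqrt_def)
qed

lemma inner_op_sqrt:
  assumes "A \<in> pos_ops"
  shows "inner (A x) x = (norm (op_sqrt A x))\<^sup>2"
proof -
  have "A x = op_sqrt A (op_sqrt A x)"
    by (metis op_sqrt(2)[OF assms] blinfun_apply_blinfun_compose)
  then show ?thesis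
    by (simp add: pos_opsD(3)[OF op_sqrt(1)[OF assms]] power2_norm_eq_inner)
qed

section \<open>The parallel sum as a projection in H x H\<close>

text \<open>With \<open>P\<close> the projection onto the orthogonal complement of \<open>{(A f, - B f)}\<close>, the operator
  is \<open>h \<mapsto> B (snd (P (0, B h)))\<close>.\<close>

lemma parallel_sum_of_squares:
  fixes A B :: "'a::complex_hilbert_space \<Rightarrow>\<^sub>L 'a"
  assumes A: "A \<in> pos_ops" and B: "B \<in> pos_ops"
  shows "\<exists>Z\<in>pos_ops.
    (\<forall>h. inner (blinfun_apply Z h) h = Inf {(norm (A f))\<^sup>2 + (norm (B g))\<^sup>2 |f g. h = f + g})
    \<and> (Z = 0 \<longleftrightarrow> range A \<inter> range B = {0})"
proof -
  let ?m = "\<lambda>f. (A f, - B f)"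
  define N where "N = closure (range ?m)"
  have "linear ?m"
    by (rule linearI) (simp_all add: blinfun.add_right blinfun.scaleR_right)
  then have "subspace (range ?m)"
    by (intro linear_subspace_image subspace_UNIV)
  then have N: "subspace N" "closed N"
    by (simp_all add: N_def subspace_closure)
  have mN: "?m f \<in> N" for f
    using closure_subset by (fastforce simp: N_def)
  obtain P where P: "bounded_linear P" and PN: "\<And>w. w - P w \<in> N"
    and orth: "\<And>w n. n \<in> N \<Longrightarrow> inner (P w) n = 0"
    and uniq: "\<And>w p. w - p \<in> N \<Longrightarrow> (\<And>n. n \<in> N \<Longrightarrow> inner p n = 0) \<Longrightarrow> P w = p"
    using orthogonal_complement_projection[OF N] by blast
  have perp: "A u = B v" if "\<And>f. inner (u, v) (?m f) = 0" for u v
  proof -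
    have "inner (A u - B v) f = 0" for f
      using that[of f] by (simp add: inner_Pair inner_diff_left pos_opsD(3)[OF A] pos_opsD(3)[OF B])
    from this[of "A u - B v"] show ?thesis by simp
  qed
  have Psa: "inner (P x) y = inner (P x) (P y)" for x y
    using orth[OF PN[of y], of x] by (simp add: inner_diff_right)
  \<comment> \<open>All splittings of h give vectors (0, B h) + (A f, - B f) with the same
    projection, whence the lower bound for the infimum.\<close>
  have P_m: "P (w + ?m f) = P w" for w f
  proof (rule uniq)
    show "w + ?m f - P w \<in> N"
      using subspace_add[OF N(1) PN mN, of w f] by (simp add: algebra_simps)
  qed (rule orth)
  have norm_P: "(norm (P w))\<^sup>2 \<le> (norm w)\<^sup>2" for w
  proof -
    have "(norm w)\<^sup>2 = (norm (P w))\<^sup>2 + (norm (w - P w))\<^sup>2"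
      using orth[OF PN[of w], of w]
      by (simp add: power2_norm_eq_inner inner_diff_left inner_diff_right inner_commute)
    then show ?thesis by simp
  qed

  define Z where "Z = Blinfun (\<lambda>h. B (snd (P (0, B h))))"
  have "bounded_linear (\<lambda>h. B (snd (P (0, B h))))"
    by (intro bounded_linear_compose[OF blinfun.bounded_linear_right]
        bounded_linear_compose[OF bounded_linear_snd] bounded_linear_compose[OF P]
        bounded_linear_Pair bounded_linear_zero blinfun.bounded_linear_right)
  then have Z: "Z h = B (snd (P (0, B h)))" for h
    by (simp add: Z_def bounded_linear_Blinfun_apply)
  have Zform: "inner (Z h) k = inner (P (0, B h)) (P (0, B k))" for h k
  proof -
    have "inner (Z h) k = inner (P (0, B h)) (0, B k)"
      by (simp add: Z pos_opsD(3)[OF B] inner_prod_def)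
    then show ?thesis using Psa by simp
  qed
  have Zsq: "inner (Z h) h = (norm (P (0, B h)))\<^sup>2" for h
    by (simp add: Zform power2_norm_eq_inner)
  have "sym_pos Z"
    unfolding sym_pos_def using Zform Zsq by (simp add: inner_commute)
  have "Z (c *\<^sub>C h) = c *\<^sub>C Z h" for c h
  proof -
    \<comment> \<open>Scalar multiplication on H x H, written out by components. \<open>N\<close> is
      invariant under every \<open>s c\<close>, whose adjoint is \<open>s (cnj c)\<close>; hence
      \<open>P\<close> commutes with \<open>s c\<close>.\<close>
    define s where "s = (\<lambda>c (p :: 'a \<times> 'a). (c *\<^sub>C fst p, c *\<^sub>C snd p))"
    have s_lin: "bounded_linear (s c)" for c
      unfolding s_def
      by (intro bounded_linear_Pair bounded_linear_compose[OF bounded_linear_scaleC]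
          bounded_linear_fst bounded_linear_snd)
    have "s c (?m f) = ?m (c *\<^sub>C f)" for c f
      using scaleC_diff_right[of c 0 "B f"]
      by (simp add: s_def pos_opsD(1)[OF A] pos_opsD(1)[OF B] scaleC_zero_right)
    then have "s c ` range ?m \<subseteq> range ?m" for c by auto
    then have sN: "s c n \<in> N" if "n \<in> N" for c n
      using closure_bounded_linear_image_subset[OF s_lin, of c "range ?m"] closure_mono that
      unfolding N_def by blast
    have s_adj: "inner (s c p) n = inner p (s (cnj c) n)" for c p n
      by (simp add: s_def inner_prod_def inner_scaleC_left)
    have "P (s c w) = s c (P w)" for w
    proof (rule uniq)
      show "s c w - s c (P w) \<in> N"
        using sN[OF PN] by (simp flip: linear_diff[OF bounded_linear.linear[OF s_lin]])
    qed (simp add: s_adj orth sN)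
    from this[of "(0, B h)"] show ?thesis
      by (simp add: Z s_def scaleC_zero_right pos_opsD(1)[OF B])
  qed
  with \<open>sym_pos Z\<close> have "Z \<in> pos_ops"
    by (simp add: pos_ops_iff)
  moreover have "inner (Z h) h = Inf {(norm (A f))\<^sup>2 + (norm (B g))\<^sup>2 |f g. h = f + g}" for h
  proof -
    have sq: "(norm (A f))\<^sup>2 + (norm (B (h - f)))\<^sup>2 = (norm ((0, B h) + ?m f))\<^sup>2" for f
      by (simp add: power2_norm_eq_inner inner_Pair blinfun.diff_right)
    have "Inf {(norm (A f))\<^sup>2 + (norm (B g))\<^sup>2 |f g. h = f + g} = (norm (P (0, B h)))\<^sup>2"
    proof (rule cInf_eq_non_empty)
      show "{(norm (A f))\<^sup>2 + (norm (B g))\<^sup>2 |f g. h = f + g} \<noteq> {}"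
        by (auto intro: exI[of _ 0])
    next
      fix x assume "x \<in> {(norm (A f))\<^sup>2 + (norm (B g))\<^sup>2 |f g. h = f + g}"
      then obtain f g where "h = f + g" "x = (norm (A f))\<^sup>2 + (norm (B g))\<^sup>2"
        by auto
      then have "x = (norm ((0, B h) + ?m f))\<^sup>2"
        using sq[of f] by simp
      then show "(norm (P (0, B h)))\<^sup>2 \<le> x"
        using norm_P[of "(0, B h) + ?m f"] unfolding P_m by simp
    next
      fix y assume y: "\<And>x. x \<in> {(norm (A f))\<^sup>2 + (norm (B g))\<^sup>2 |f g. h = f + g} \<Longrightarrow> y \<le> x"
      have y_le: "y \<le> (norm ((0, B h) + ?m f))\<^sup>2" for f
        unfolding sq[symmetric]
        by (rule y, rule CollectI, rule exI[of _ f], rule exI[of _ "h - f"]) simp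
      \<comment> \<open>The component of (0, B h) in the closure \<open>N\<close> is approximated
        from the subspace itself, whose points correspond to genuine splittings.\<close>
      obtain m where m: "\<And>n. m n \<in> range ?m" "m \<longlonglongrightarrow> (0, B h) - P (0, B h)"
        using PN[of "(0, B h)"] unfolding N_def closure_sequential by blast
      have "y \<le> (norm ((0, B h) - m n))\<^sup>2" for n
      proof -
        obtain f where "m n = ?m f" using m(1)[of n] by auto
        then have "(0, B h) - m n = (0, B h) + ?m (- f)"
          by (simp add: blinfun.minus_right)
        then show ?thesis using y_le by simp
      qed
      moreover have "(\<lambda>n. (norm ((0, B h) - m n))\<^sup>2) \<longlonglongrightarrow> (norm ((0, B h) - ((0, B h) - P (0, B h))))\<^sup>2"
        by (intro tendsto_intros m(2))
      ultimately show "y \<le> (norm (P (0, B h)))\<^sup>2"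
        by (intro LIMSEQ_le_const[of "\<lambda>n. (norm ((0, B h) - m n))\<^sup>2"]) auto
    qed
    then show ?thesis using Zsq by simp
  qed
  moreover have "Z = 0 \<longleftrightarrow> range A \<inter> range B = {0}"
  proof
    assume "Z = 0"
    then have P0: "P (0, B h) = 0" for h
      using Zsq[of h] by simp
    have "A u = 0" if uv: "A u = B v" for u v
    proof -
      have "range ?m \<subseteq> {n. inner (u, v) n = 0}"
        using uv by (auto simp: inner_Pair simp flip: pos_opsD(3)[OF A] pos_opsD(3)[OF B])
      then have "N \<subseteq> {n. inner (u, v) n = 0}"
        unfolding N_def by (intro closure_minimal closed_hyperplane)
      \<comment> \<open>The choice h = B v makes orthogonality to (u, v) read (v, B (B v)) = |B v|^2
        = 0.\<close>
      moreover have "(0, B (B v)) \<in> N"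
        using PN[of "(0, B (B v))"] P0 by simp
      ultimately have "inner v (B (B v)) = 0"
        by (auto simp: inner_Pair)
      then show ?thesis
        using uv pos_opsD(3)[OF B, of v "B v"] by simp
    qed
    moreover have "0 \<in> range A \<inter> range B"
      by (metis IntI blinfun.zero_right rangeI)
    ultimately show "range A \<inter> range B = {0}" by auto
  next
    assume disj: "range A \<inter> range B = {0}"
    show "Z = 0"
    proof (rule blinfun_eqI)
      fix h
      obtain u v where uv: "P (0, B h) = (u, v)" by (cases "P (0, B h)")
      then have "inner (u, v) (?m f) = 0" for f
        using orth[OF mN, of "(0, B h)" f] by simp
      then have "A u = B v" by (rule perp)
      \<comment> \<open>Here \<open>B v\<close> is exactly \<open>Z h\<close>.\<close>
      then have "B v \<in> range A \<inter> range B"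
        by (metis IntI rangeI)
      then show "Z h = blinfun_apply 0 h"
        using disj by (simp add: Z uv)
    qed
  qed
  ultimately show ?thesis by (intro bexI[of _ Z] conjI allI)
qed

text \<open>Square roots turn both forms into squared norms, which gives existence; uniqueness holds
  because a positive operator is determined by its form.\<close>

lemma parallel_sum:
  assumes X: "X \<in> pos_ops" and G: "G \<in> pos_ops"
  shows parallel_sum_in_pos_ops: "parallel_sum X G \<in> pos_ops"
    and inner_parallel_sum:
      "inner (parallel_sum X G h) h = Inf {inner (X f) f + inner (G g) g |f g. h = f + g}"
    and parallel_sum_eq_0_iff:
      "parallel_sum X G = 0 \<longleftrightarrow> range (op_sqrt X) \<inter> range (op_sqrt G) = {0}"
proof -
  define q where "q = (\<lambda>h. Inf {inner (X f) f + inner (G g) g |f g. h = f + g})"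
  have "\<exists>Z\<in>pos_ops. (\<forall>h. inner (blinfun_apply Z h) h = q h)
      \<and> (Z = 0 \<longleftrightarrow> range (op_sqrt X) \<inter> range (op_sqrt G) = {0})"
    unfolding q_def inner_op_sqrt[OF X] inner_op_sqrt[OF G]
    by (rule parallel_sum_of_squares[OF op_sqrt(1)[OF X] op_sqrt(1)[OF G]])
  then obtain Z where Z: "Z \<in> pos_ops" "\<forall>h. inner (Z h) h = q h"
    and Z0: "Z = 0 \<longleftrightarrow> range (op_sqrt X) \<inter> range (op_sqrt G) = {0}"
    by (elim bexE conjE) (rule that)
  have "parallel_sum X G = (THE Z. Z \<in> pos_ops \<and> (\<forall>h. inner (blinfun_apply Z h) h = q h))"
    by (simp only: parallel_sum_def q_def inner_eq_Re_cinner)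
  also have "\<dots> = Z"
  proof (rule the_equality)
    show "Z' = Z" if "Z' \<in> pos_ops \<and> (\<forall>h. inner (blinfun_apply Z' h) h = q h)" for Z'
      using that Z by (intro pos_ops_form_eqI) simp_all
  qed (use Z in blast)
  finally have eq: "parallel_sum X G = Z" .
  show "parallel_sum X G \<in> pos_ops"
    using Z(1) eq by simp
  show "inner (parallel_sum X G h) h = Inf {inner (X f) f + inner (G g) g |f g. h = f + g}"
    using Z(2) unfolding eq q_def by blast
  show "parallel_sum X G = 0 \<longleftrightarrow> range (op_sqrt X) \<inter> range (op_sqrt G) = {0}"
    using Z0 unfolding eq .
qed

lemma inner_parallel_sum_le:
  assumes X: "X \<in> pos_ops" and G: "G \<in> pos_ops"
  shows "inner (parallel_sum X G (f + g)) (f + g) \<le> inner (X f) f + inner (G g) g"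
  unfolding inner_parallel_sum[OF assms]
proof (rule cInf_lower)
  show "bdd_below {inner (X f') f' + inner (G g') g' |f' g'. f + g = f' + g'}"
    by (rule bdd_belowI[of _ 0]) (auto simp: pos_opsD(4)[OF X] pos_opsD(4)[OF G])
qed auto

lemma parallel_sum_mono:
  assumes X: "X \<in> pos_ops" and Y: "Y \<in> pos_ops" and G: "G \<in> pos_ops"
    and le: "\<And>x. inner (X x) x \<le> inner (Y x) x"
  shows "inner (parallel_sum X G h) h \<le> inner (parallel_sum Y G h) h"
  unfolding inner_parallel_sum[OF Y G]
proof (rule cInf_greatest)
  show "{inner (Y f) f + inner (G g) g |f g. h = f + g} \<noteq> {}"
    by (auto intro: exI[of _ 0])
next
  fix x assume "x \<in> {inner (Y f) f + inner (G g) g |f g. h = f + g}"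
  then obtain f g where "h = f + g" "x = inner (Y f) f + inner (G g) g" by auto
  then show "inner (parallel_sum X G h) h \<le> x"
    using inner_parallel_sum_le[OF X G, of f g] le[of f] by simp
qed

section \<open>The map \<open>mu\<close>, its strong limit \<open>tau\<close> and their fixed
  points\<close>

lemma mu_in_pos_ops:
  assumes X: "X \<in> pos_ops" and G: "G \<in> pos_ops"
  shows "mu G X \<in> pos_ops"
  unfolding mu_def
proof (rule pos_ops_diff[OF X parallel_sum_in_pos_ops[OF X G]])
  fix x
  show "inner (parallel_sum X G x) x \<le> inner (X x) x"
    \<comment> \<open>The trivial splitting x = x + 0 bounds the parallel sum by
      \<open>X\<close>.\<close>
    using inner_parallel_sum_le[OF X G, of x 0] by (simp add: blinfun.zero_right)
qed

lemma mu_eq_self_iff: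
  assumes "X \<in> pos_ops" "G \<in> pos_ops"
  shows "mu G X = X \<longleftrightarrow> X \<in> pos_ops_disj G"
  using parallel_sum_eq_0_iff[OF assms] assms by (auto simp: mu_def pos_ops_disj_def)

text \<open>For each x the numbers (X_n x, x) decrease and are bounded below, hence form a Cauchy
  sequence. Each difference X_m - X_n with m \<le> n is positive with form at most k |x|^2, where
  \<open>k\<close> depends only on \<open>X 0\<close>, so |X_m x - X_n x|^2 is at most k times the
  difference of these numbers.\<close>

lemma decreasing_pos_ops_strong_limit:
  fixes X :: "nat \<Rightarrow> ('a::complex_hilbert_space \<Rightarrow>\<^sub>L 'a)"
  assumes X: "\<And>n. X n \<in> pos_ops" and dec: "\<And>n. X n - X (Suc n) \<in> pos_ops"
  obtains T where "T \<in> pos_ops" "\<And>h. (\<lambda>n. X n h) \<longlonglongrightarrow> T h"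
    "\<And>n x. inner (T x) x \<le> inner (X n x) x"
proof -
  have "X m - X (m + j) \<in> pos_ops" for m j
  proof (induction j)
    case (Suc j)
    from pos_ops_add[OF this dec[of "m + j"]] show ?case by simp
  qed (simp add: zero_in_pos_ops)
  then have diff: "X m - X n \<in> pos_ops" if "m \<le> n" for m n
    using that le_Suc_ex by blast
  have le: "inner (X n x) x \<le> inner (X m x) x" if "m \<le> n" for m n x
    using pos_opsD(4)[OF diff[OF that], of x] by (simp add: blinfun.diff_left inner_diff_left)
  define k where "k = norm (X 0) + 1"
  have k: "k > 0" by (simp add: k_def add_nonneg_pos)
  have bound: "inner (X n y) y \<le> k * (norm y)\<^sup>2" for n y
    using le[of 0 n y] inner_blinfun_le_Suc[of "X 0" y] by (simp add: k_def)
  have step: "(norm (X m x - X n x))\<^sup>2 \<le> k * (inner (X m x) x - inner (X n x) x)" if "m \<le> n" for m n x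
  proof -
    have "inner ((X m - X n) y) y \<le> k * (norm y)\<^sup>2" for y
      using bound[of m y] pos_opsD(4)[OF X, of n y]
      by (simp only: blinfun.diff_left inner_diff_left)
    from sym_pos_norm_sq_le[OF pos_opsD(2)[OF diff[OF that]] k this, of x] show ?thesis
      by (simp only: blinfun.diff_left inner_diff_left)
  qed
  have "Cauchy (\<lambda>n. X n x)" for x
  proof (rule metric_CauchyI)
    fix e :: real assume e: "e > 0"
    have "decseq (\<lambda>n. inner (X n x) x)"
      using le by (simp add: decseq_def)
    from decseq_convergent[OF this, of 0] obtain l where "(\<lambda>n. inner (X n x) x) \<longlonglongrightarrow> l"
      using pos_opsD(4)[OF X] by metis
    then have "Cauchy (\<lambda>n. inner (X n x) x)"
      by (rule LIMSEQ_imp_Cauchy)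
    moreover have "e\<^sup>2 / k > 0" using e k by simp
    ultimately obtain M where
      M: "\<And>m n. M \<le> m \<Longrightarrow> M \<le> n \<Longrightarrow> dist (inner (X m x) x) (inner (X n x) x) < e\<^sup>2 / k"
      by (meson metric_CauchyD)
    have ord: "dist (X m x) (X n x) < e" if "M \<le> m" "m \<le> n" for m n
    proof -
      have "inner (X m x) x - inner (X n x) x < e\<^sup>2 / k"
        using M[of m n] that by (simp add: dist_real_def)
      then have "k * (inner (X m x) x - inner (X n x) x) < e\<^sup>2"
        using k by (simp add: pos_less_divide_eq mult.commute)
      then have "(norm (X m x - X n x))\<^sup>2 < e\<^sup>2"
        using step[OF that(2), of x] by linarith
      then show ?thesis
        using e by (simp add: dist_norm power2_less_imp_less)
    qed
    have "dist (X m x) (X n x) < e" if "M \<le> m" "M \<le> n" for m n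
      using ord[of m n] ord[of n m] that by (cases "m \<le> n") (auto simp: dist_commute)
    then show "\<exists>M. \<forall>m\<ge>M. \<forall>n\<ge>M. dist (X m x) (X n x) < e" by blast
  qed
  then have "\<exists>l. (\<lambda>n. X n x) \<longlonglongrightarrow> l" for x
    using Cauchy_convergent unfolding convergent_def by blast
  then obtain t where t: "\<And>x. (\<lambda>n. X n x) \<longlonglongrightarrow> t x"
    by metis
  have "bounded_linear t"
  proof (rule bounded_linear_intro[where K = k])
    show "t (x + y) = t x + t y" for x y
      using LIMSEQ_unique[OF t[of "x + y"]] tendsto_add[OF t[of x] t[of y]]
      by (simp add: blinfun.add_right)
    show "t (r *\<^sub>R x) = r *\<^sub>R t x" for r x
      using LIMSEQ_unique[OF t[of "r *\<^sub>R x"]] tendsto_scaleR[OF tendsto_const t[of x]]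
      by (simp add: blinfun.scaleR_right)
    show "norm (t x) \<le> norm x * k" for x
    proof -
      have "norm (X n x) \<le> norm x * k" for n
      proof (rule power2_le_imp_le)
        have "(norm (X n x))\<^sup>2 \<le> k * inner (X n x) x"
          by (rule sym_pos_norm_sq_le[OF pos_opsD(2)[OF X] k bound])
        also have "\<dots> \<le> k * (k * (norm x)\<^sup>2)"
          using k bound by (intro mult_left_mono) auto
        finally show "(norm (X n x))\<^sup>2 \<le> (norm x * k)\<^sup>2"
          by (simp add: power2_eq_square mult_ac)
      qed (use k in simp)
      then show ?thesis
        by (intro LIMSEQ_le_const2[OF tendsto_norm[OF t]]) auto
    qed
  qed
  then have T: "Blinfun t x = t x" for x
    by (simp add: bounded_linear_Blinfun_apply)
  have form: "(\<lambda>n. inner (X n x) y) \<longlonglongrightarrow> inner (t x) y" for x y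
    by (intro tendsto_intros t)
  show thesis
  proof (rule that[of "Blinfun t"])
    show "(\<lambda>n. X n h) \<longlonglongrightarrow> Blinfun t h" for h
      unfolding T by (rule t)
    show "inner (Blinfun t x) x \<le> inner (X n x) x" for n x
      unfolding T using le by (intro LIMSEQ_le_const2[OF form]) auto
    have "t (c *\<^sub>C x) = c *\<^sub>C t x" for c x
      using LIMSEQ_unique[OF t[of "c *\<^sub>C x"]]
        bounded_linear.tendsto[OF bounded_linear_scaleC t[of x], of c]
      by (simp add: pos_opsD(1)[OF X])
    moreover have "inner (t x) y = inner x (t y)" for x y
    proof (rule LIMSEQ_unique[OF form])
      show "(\<lambda>n. inner (X n x) y) \<longlonglongrightarrow> inner x (t y)"
        unfolding pos_opsD(3)[OF X, of _ x y] by (intro tendsto_intros t)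
    qed
    moreover have "0 \<le> inner (t x) x" for x
      using pos_opsD(4)[OF X] by (intro LIMSEQ_le_const[OF form]) auto
    ultimately show "Blinfun t \<in> pos_ops"
      unfolding pos_ops_iff sym_pos_def T by blast
  qed
qed

lemma tau:
  assumes G: "G \<in> pos_ops" and X: "X \<in> pos_ops"
  shows tau_in_pos_ops: "tau G X \<in> pos_ops"
    and tendsto_tau: "(\<lambda>n. (mu G ^^ n) X h) \<longlonglongrightarrow> tau G X h"
    and inner_tau_le: "inner (tau G X x) x \<le> inner ((mu G ^^ n) X x) x"
proof -
  have Xn: "(mu G ^^ n) X \<in> pos_ops" for n
    by (induction n) (simp_all add: X mu_in_pos_ops G)
  have dec: "(mu G ^^ n) X - (mu G ^^ Suc n) X \<in> pos_ops" for n
    using parallel_sum_in_pos_ops[OF Xn G] by (simp add: mu_def)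
  obtain T where T: "T \<in> pos_ops" "\<And>h. (\<lambda>n. (mu G ^^ n) X h) \<longlonglongrightarrow> T h"
    "\<And>n x. inner (T x) x \<le> inner ((mu G ^^ n) X x) x"
    using decreasing_pos_ops_strong_limit[where X = "\<lambda>n. (mu G ^^ n) X", OF Xn dec] by blast
  have "tau G X = T"
    unfolding tau_def using T(1,2)
    by (intro the_equality blinfun_eqI) (auto intro: LIMSEQ_unique)
  with T show "tau G X \<in> pos_ops" "(\<lambda>n. (mu G ^^ n) X h) \<longlonglongrightarrow> tau G X h"
    "inner (tau G X x) x \<le> inner ((mu G ^^ n) X x) x"
    by auto
qed

lemma tau_in_pos_ops_disj:
  assumes G: "G \<in> pos_ops" and X: "X \<in> pos_ops"
  shows "tau G X \<in> pos_ops_disj G"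
proof -
  let ?T = "tau G X" and ?X = "\<lambda>n. (mu G ^^ n) X"
  have T: "?T \<in> pos_ops" by (rule tau_in_pos_ops[OF assms])
  note TG = parallel_sum_in_pos_ops[OF T G]
  have Xn: "?X n \<in> pos_ops" for n
    by (induction n) (simp_all add: X mu_in_pos_ops G)
  have "inner (parallel_sum ?T G h) h = 0" for h
  proof (rule antisym)
    have le: "inner (parallel_sum ?T G h) h \<le> inner (?X n h - ?X (Suc n) h) h" for n
      using parallel_sum_mono[OF T Xn G inner_tau_le[OF assms], of h n]
      by (simp add: mu_def blinfun.diff_left)
    have "(\<lambda>n. inner (?X n h - ?X (Suc n) h) h) \<longlonglongrightarrow> inner (?T h - ?T h) h"
      by (intro tendsto_intros tendsto_tau[OF assms] LIMSEQ_Suc[OF tendsto_tau[OF assms]])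
    then show "inner (parallel_sum ?T G h) h \<le> 0"
      using le by (intro LIMSEQ_le_const[of "\<lambda>n. inner (?X n h - ?X (Suc n) h) h"]) auto
  qed (rule pos_opsD(4)[OF TG])
  then have "parallel_sum ?T G = 0"
    by (intro pos_ops_form_eqI TG zero_in_pos_ops) simp
  then show ?thesis
    using mu_eq_self_iff[OF T G] by (simp add: mu_def)
qed

lemma tau_eq_self:
  assumes G: "G \<in> pos_ops" and X: "X \<in> pos_ops_disj G"
  shows "tau G X = X"
proof (rule blinfun_eqI)
  fix h
  have Xpos: "X \<in> pos_ops" using X by (simp add: pos_ops_disj_def)
  then have "mu G X = X" using mu_eq_self_iff[OF _ G] X by blast
  then have "(mu G ^^ n) X = X" for n by (induction n) simp_all
  then show "tau G X h = X h"
    using tendsto_tau[OF G Xpos, of h] by (simp add: LIMSEQ_const_iff)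
qed

theorem mainTheorem3:
  fixes G :: "'a::complex_hilbert_space \<Rightarrow>\<^sub>L 'a"
  assumes "G \<in> pos_ops"
  shows "pos_ops_disj G = {X \<in> pos_ops. mu G X = X}
    \<and> pos_ops_disj G = {X \<in> pos_ops. tau G X = X}
    \<and> pos_ops_disj G = tau G ` pos_ops"
proof -
  have sub: "pos_ops_disj G \<subseteq> pos_ops" by (auto simp: pos_ops_disj_def)
  have fix_mu: "pos_ops_disj G = {X \<in> pos_ops. mu G X = X}"
    using mu_eq_self_iff[OF _ assms] sub by auto
  have self: "tau G X = X" if "X \<in> pos_ops_disj G" for X
    by (rule tau_eq_self[OF assms that])
  have disj: "tau G X \<in> pos_ops_disj G" if "X \<in> pos_ops" for X
    by (rule tau_in_pos_ops_disj[OF assms that])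
  have "pos_ops_disj G = {X \<in> pos_ops. tau G X = X}"
    using self disj sub by force
  \<comment> \<open>Every member is the image of itself, which gives the inclusion into the
    range.\<close>
  moreover have "pos_ops_disj G = tau G ` pos_ops"
    using self disj sub by force
  ultimately show ?thesis using fix_mu by blast
qed

end
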